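(* There is an absolute constant $c>0$ such that for every dyadic interval $\Delta=\Delta_k^{(n)}$ ($n\ge0$, $1\le k\le2^n$) and all integers $r>0$, $1\le t\le2^r$, $l\ge1$, the set $G=G_l(\Delta,r,t)$ (defined in the context) satisfies $$|\{x\in[0,1): S^*(x,\mathbf 1_G)>\lambda\}|\le c\cdot\frac{|G|}{\lambda},\quad\lambda>0.$$
   Context: $|E|$ denotes Lebesgue measure and $\mathbf 1_E$ the indicator function of $E$. $\{w_n\}_{n\ge0}$ is the Walsh system on $[0,1)$ in Paley order: if $n=\sum_{k\ge0}n_k2^k$ with $n_k\in\{0,1\}$ and $x=\sum_{k\ge0}x_k2^{-k-1}$ with $x_k\in\{0,1\}$ (finite expansion for dyadic rationals), then $w_n(x)=(-1)^{\sum_kn_kx_k}$. For $f\in L^1(0,1)$, $S_m(x,f)=\sum_{n=0}^{m-1}a_n(f)w_n(x)$ with $a_n(f)=\int_0^1fw_n$, and $S^*(x,f)=\sup_m|S_m(x,f)|$. Dyadic intervals: $\Delta_k^{(n)}=\left[\frac{k-1}{2^n},\frac{k}{2^n}\right)$, $1\le k\le2^n$, $n=0,1,2,\ldots$. Sets in $[0,1)$ are continued $1$-periodically; for $E\subset[0,1)$ and an integer $N>0$, $E(N)=\{x\in[0,1): Nx\in E\}$ with $E$ so continued (i.e. the fractional part of $Nx$ lies in $E$). Finally $$G_l(\Delta,r,t)=\Delta\cap\big(\Delta_t^{(r)}(2^l)\big).$$ *)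

theory Defs
  imports "HOL-Analysis.Analysis"
begin

definition nat_digit :: "nat \<Rightarrow> nat \<Rightarrow> nat" where
  "nat_digit n k = n div 2 ^ k mod 2"

text \<open>For \<open>x \<in> [0,1)\<close> these are the digits in \<open>x = (\<Sum>k. x\<^sub>k 2\<^bsup>-k-1\<^esup>)\<close>; taking the floor selects
  the finite expansion when \<open>x\<close> is a dyadic rational.\<close>
definition real_digit :: "real \<Rightarrow> nat \<Rightarrow> nat" where
  "real_digit x k = nat (\<lfloor>2 ^ Suc k * x\<rfloor> mod 2)"

text \<open>Paley order. The sum over all \<open>k\<close> may be cut off at \<open>n\<close> because \<open>nat_digit n k = 0\<close> for \<open>k \<ge> n\<close>.\<close>
definition walsh :: "nat \<Rightarrow> real \<Rightarrow> real" where
  "walsh n x = (- 1) ^ (\<Sum>k<n. nat_digit n k * real_digit x k)"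

definition walsh_coeff :: "(real \<Rightarrow> real) \<Rightarrow> nat \<Rightarrow> real" where
  "walsh_coeff f n = (LINT x:{0..<1}|lebesgue. f x * walsh n x)"

definition walsh_partial_sum :: "nat \<Rightarrow> real \<Rightarrow> (real \<Rightarrow> real) \<Rightarrow> real" where
  "walsh_partial_sum m x f = (\<Sum>n<m. walsh_coeff f n * walsh n x)"

text \<open>Extended-real valued, since the supremum may be infinite.\<close>
definition walsh_maximal :: "real \<Rightarrow> (real \<Rightarrow> real) \<Rightarrow> ereal" where
  "walsh_maximal x f = (SUP m. ereal \<bar>walsh_partial_sum m x f\<bar>)"

definition dyadic_interval :: "nat \<Rightarrow> nat \<Rightarrow> real set" where
  "dyadic_interval n k = {(real k - 1) / 2 ^ n ..< real k / 2 ^ n}"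

definition periodic_dilate :: "real set \<Rightarrow> nat \<Rightarrow> real set" where
  "periodic_dilate E N = {x \<in> {0..<1}. frac (real N * x) \<in> E}"

definition G_set :: "nat \<Rightarrow> real set \<Rightarrow> nat \<Rightarrow> nat \<Rightarrow> real set" where
  "G_set l \<Delta> r t = \<Delta> \<inter> periodic_dilate (dyadic_interval r t) (2 ^ l)"

lemma nat_digit_eq_0: "n \<le> k \<Longrightarrow> nat_digit n k = 0"
  unfolding nat_digit_def
  by (metis div_less less_exp mod_0 order_le_less_trans)

lemma real_digit_partial_sum:
  assumes "0 \<le> x" "x < 1"
  shows "(\<Sum>k<m. real (real_digit x k) / 2 ^ Suc k) = real_of_int \<lfloor>2 ^ m * x\<rfloor> / 2 ^ m"
proof (induction m)
  case 0
  then show ?case using assms by (simp add: floor_eq_iff)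
next
  case (Suc m)
  have "\<lfloor>2 ^ Suc m * x\<rfloor> div 2 = \<lfloor>2 ^ m * x\<rfloor>"
    using floor_divide_real_eq_div[of 2 "2 ^ Suc m * x"] by simp
  then have "\<lfloor>2 ^ Suc m * x\<rfloor> = 2 * \<lfloor>2 ^ m * x\<rfloor> + \<lfloor>2 ^ Suc m * x\<rfloor> mod 2"
    by (metis mult_div_mod_eq)
  moreover have "real (real_digit x m) = real_of_int (\<lfloor>2 ^ Suc m * x\<rfloor> mod 2)"
    unfolding real_digit_def by simp
  ultimately have "real_of_int \<lfloor>2 ^ Suc m * x\<rfloor> = 2 * real_of_int \<lfloor>2 ^ m * x\<rfloor> + real (real_digit x m)"
    by (metis of_int_add of_int_mult of_int_numeral)
  then show ?case using Suc by (simp add: field_simps)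
qed

lemma walsh_borel_measurable [measurable]: "walsh n \<in> borel_measurable borel"
  unfolding walsh_def real_digit_def by measurable

lemma walsh_maximal_level_set_borel: "{x \<in> {0..<1}. walsh_maximal x f > y} \<in> sets borel"
  unfolding walsh_maximal_def walsh_partial_sum_def by measurable

end

theory Submission
  imports Defs
begin

text \<open>
  If nonempty, the set \<open>G\<close> consists of the points of \<open>[0,1)\<close> whose binary digits at a finite set \<open>A\<close>
  of positions agree with prescribed digits \<open>d\<close>, so \<open>|G| = 2\<^bsup>-|A|\<^esup>\<close>, and the coefficient of its
  indicator at \<open>w\<^sub>j\<close> is \<open>\<plusminus>2\<^bsup>-|A|\<^esup>\<close> if the binary digits of \<open>j\<close> are supported in \<open>A\<close>, and \<open>0\<close> otherwise.
  If \<open>x\<close> disagrees with \<open>d\<close> at \<open>a \<in> A\<close>, then in a partial sum at \<open>x\<close> the terms \<open>j\<close> and \<open>j + 2\<^sup>a\<close> cancel, and the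
  frequencies left unpaired by the cutoff \<open>m\<close> lie in \<open>[m - 2\<^sup>a, m)\<close>; they number at most \<open>2\<^bsup>|A \<inter> [0,a)|\<^esup>\<close>.
  Hence \<open>S\<^sup>*(x) > \<lambda>\<close> forces agreement at every \<open>a \<in> A\<close> with
  \<open>2\<^bsup>|A \<inter> [0,a)|\<^esup> \<le> \<lambda> 2\<^bsup>|A|\<^esup>\<close>, and the set of such \<open>x\<close> has measure at most \<open>|G| / \<lambda>\<close>.
\<close>

section \<open>Binary digits: cylinders, supports and signs\<close>

definition digit_cylinder :: "nat set \<Rightarrow> (nat \<Rightarrow> nat) \<Rightarrow> real set" where
  "digit_cylinder A d = {x \<in> {0..<1}. \<forall>i\<in>A. real_digit x i = d i}"

text \<open>Phrased with \<open>bit\<close>, so that the facts on \<open>set_bit\<close>,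
  \<open>unset_bit\<close> and \<open>take_bit\<close> apply.\<close>

definition digit_support :: "nat \<Rightarrow> nat set" where
  "digit_support n = {k. bit n k}"

text \<open>The free digit sequence \<open>d\<close> lets one expression serve as a Walsh function
  at a point, as the sign of a coefficient and, with two sequences added, as the product of
  both.\<close>

definition digit_sign :: "nat set \<Rightarrow> (nat \<Rightarrow> nat) \<Rightarrow> real" where
  "digit_sign S d = (\<Prod>k\<in>S. (- 1) ^ d k)"

lemma real_digit_cases: "real_digit x k = 0 \<or> real_digit x k = 1"
  unfolding real_digit_def by linarith

lemma abs_digit_sign [simp]: "\<bar>digit_sign S d\<bar> = 1"
  unfolding digit_sign_def by (simp add: abs_prod power_abs)

lemma digit_support_subset: "digit_support n \<subseteq> {..<n}"
proof
  fix k assume "k \<in> digit_support n"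
  then have "bit n k" by (simp add: digit_support_def)
  then have "n div 2 ^ k \<noteq> 0" unfolding bit_iff_odd by (metis even_zero)
  then have "2 ^ k \<le> n" by (simp add: div_eq_0_iff)
  then show "k \<in> {..<n}"
    by (metis lessThan_iff less_exp order_less_le_trans)
qed

lemma finite_digit_support [simp]: "finite (digit_support n)"
  using digit_support_subset finite_subset by blast

lemma inj_digit_support: "inj digit_support"
  by (auto simp: inj_def digit_support_def set_eq_iff bit_eq_iff)

text \<open>A number is determined by its digit support, so these numbers inject into
  \<open>Pow F\<close>.\<close>

lemma card_digit_support_subset_le:
  assumes "finite F"
  shows "finite {i. digit_support i \<subseteq> F}" "card {i. digit_support i \<subseteq> F} \<le> 2 ^ card F"
proof -
  have sub: "digit_support ` {i. digit_support i \<subseteq> F} \<subseteq> Pow F" by auto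
  have inj: "inj_on digit_support {i. digit_support i \<subseteq> F}"
    using inj_digit_support inj_on_subset by blast
  show "finite {i. digit_support i \<subseteq> F}"
    using inj_on_finite[OF inj sub] assms by simp
  show "card {i. digit_support i \<subseteq> F} \<le> 2 ^ card F"
    using card_inj_on_le[OF inj sub] assms by (simp add: card_Pow)
qed

lemma walsh_eq_digit_sign: "walsh n x = digit_sign (digit_support n) (real_digit x)"
proof -
  have "walsh n x = (\<Prod>k<n. (- 1) ^ (nat_digit n k * real_digit x k))"
    unfolding walsh_def by (rule power_sum)
  also have "\<dots> = (\<Prod>k\<in>digit_support n. (- 1) ^ (nat_digit n k * real_digit x k))"
    by (rule prod.mono_neutral_right)
      (use digit_support_subset in \<open>auto simp: nat_digit_def digit_support_def bit_iff_odd even_iff_mod_2_eq_zero\<close>)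
  also have "\<dots> = digit_sign (digit_support n) (real_digit x)"
    unfolding digit_sign_def
    by (rule prod.cong) (auto simp: nat_digit_def digit_support_def bit_iff_odd odd_iff_mod_2_eq_one)
  finally show ?thesis .
qed

section \<open>Measure of digit cylinders\<close>

lemma digit_cylinder_measurable [measurable]: "finite A \<Longrightarrow> digit_cylinder A d \<in> sets borel"
  unfolding digit_cylinder_def real_digit_def by measurable

lemma digit_cylinder_finite_measure:
  "finite A \<Longrightarrow> emeasure lebesgue (digit_cylinder A d) < \<infinity>"
proof -
  have "emeasure lebesgue (digit_cylinder A d) \<le> emeasure lebesgue {0..<1::real}"
    by (rule emeasure_mono) (auto simp: digit_cylinder_def)
  then show ?thesis by (simp add: order_le_less_trans)
qed

text \<open>Appending the digit \<open>d N\<close> turns the floor \<open>v\<close> into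
  \<open>2 * v + d N\<close>. In the base case a floor equal to 0 already encodes membership in
  [0,1).\<close>

lemma digit_cylinder_lessThan:
  assumes "\<And>i. i < N \<Longrightarrow> d i \<in> {0, 1}"
  shows "\<exists>v. digit_cylinder {..<N} d = {x. \<lfloor>2 ^ N * x\<rfloor> = v}"
  using assms
proof (induction N)
  case 0
  have "digit_cylinder {..<0} d = {x. \<lfloor>2 ^ 0 * x\<rfloor> = 0}"
    by (auto simp: digit_cylinder_def floor_eq_iff)
  then show ?case by blast
next
  case (Suc N)
  then obtain v where v: "digit_cylinder {..<N} d = {x. \<lfloor>2 ^ N * x\<rfloor> = v}" by auto
  have dN: "d N = 0 \<or> d N = 1" using Suc.prems[of N] by simp
  have "digit_cylinder {..<Suc N} d = {x \<in> digit_cylinder {..<N} d. real_digit x N = d N}"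
    by (auto simp: digit_cylinder_def less_Suc_eq)
  also have "\<dots> = {x. \<lfloor>2 ^ Suc N * x\<rfloor> = 2 * v + int (d N)}"
  proof -
    have "\<lfloor>2 ^ N * x\<rfloor> = v \<and> real_digit x N = d N \<longleftrightarrow> \<lfloor>2 ^ Suc N * x\<rfloor> = 2 * v + int (d N)" for x
    proof -
      have "\<lfloor>2 ^ Suc N * x\<rfloor> div 2 = \<lfloor>2 ^ N * x\<rfloor>"
        using floor_divide_real_eq_div[of 2 "2 ^ Suc N * x"] by simp
      moreover have "nat (w mod 2) = d N \<longleftrightarrow> w mod 2 = int (d N)" for w :: int
        using dN by auto
      moreover have "w div 2 = v \<and> w mod 2 = int (d N) \<longleftrightarrow> w = 2 * v + int (d N)" for w
        using dN by presburger
      note this[of "\<lfloor>2 ^ Suc N * x\<rfloor>"]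
      ultimately show ?thesis unfolding real_digit_def by (simp only:)
    qed
    then show ?thesis using v by auto
  qed
  finally show ?case by blast
qed

text \<open>Downward induction from \<open>A = {..<N}\<close>, where the cylinder is a dyadic
  interval of length 1/2^N. A free position below \<open>N\<close> splits a cylinder into two with
  one more prescribed digit, and their measures add up.\<close>

lemma measure_digit_cylinder:
  assumes "finite A" "\<And>i. i \<in> A \<Longrightarrow> d i \<in> {0, 1}"
  shows "measure lebesgue (digit_cylinder A d) = 1 / 2 ^ card A"
proof -
  obtain N where "A \<subseteq> {..<N}" using assms(1) finite_nat_iff_bounded by blast
  then show ?thesis using assms
  proof (induction "N - card A" arbitrary: A d)
    case 0
    have "card A = N"
      using 0 card_mono[of "{..<N}" A] by simp
    then have A: "A = {..<N}" using 0(2) card_subset_eq[of "{..<N}" A] by simp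
    obtain v where "digit_cylinder A d = {x. \<lfloor>2 ^ N * x\<rfloor> = v}"
      using digit_cylinder_lessThan[of N d] 0(4) A by auto
    also have "\<dots> = {v / 2 ^ N ..< (v + 1) / 2 ^ N}"
      by (auto simp: floor_eq_iff field_simps)
    finally have "measure lebesgue (digit_cylinder A d) = (v + 1) / 2 ^ N - v / 2 ^ N"
      by (simp add: divide_right_mono)
    then show ?case using \<open>card A = N\<close> by (simp add: add_divide_distrib)
  next
    case (Suc k)
    then have "A \<noteq> {..<N}" by auto
    then obtain i where i: "i < N" "i \<notin> A" using Suc.prems(1) by blast
    let ?C = "\<lambda>b. digit_cylinder (insert i A) (d(i := b))"
    have M: "measure lebesgue (?C b) = 1 / 2 ^ Suc (card A)" if "b \<in> {0, 1}" for b
    proof -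
      have "measure lebesgue (?C b) = 1 / 2 ^ card (insert i A)"
        using Suc.hyps(2) Suc.prems i that by (intro Suc.hyps(1)) auto
      then show ?thesis using i Suc.prems by simp
    qed
    have "digit_cylinder A d = ?C 0 \<union> ?C 1"
      using i real_digit_cases by (auto simp: digit_cylinder_def)
    moreover have "?C 0 \<inter> ?C 1 = {}" by (auto simp: digit_cylinder_def)
    ultimately have "measure lebesgue (digit_cylinder A d)
        = measure lebesgue (?C 0) + measure lebesgue (?C 1)"
      using Suc.prems(2) digit_cylinder_finite_measure[of "insert i A"]
      by (simp add: measure_Union less_top)
    then show ?case by (simp add: M field_simps)
  qed
qed

section \<open>Walsh coefficients and partial sums of cylinder indicators\<close>

lemma integrable_indicator_mult_digit_sign:
  assumes "finite A" "finite S"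
  shows "integrable lebesgue (\<lambda>x. indicator (digit_cylinder A d) x * digit_sign S (real_digit x))"
proof (rule Bochner_Integration.integrable_bound)
  show "integrable lebesgue (indicator (digit_cylinder A d) :: real \<Rightarrow> real)"
    using digit_cylinder_finite_measure[OF assms(1)] assms(1) by (simp add: integrable_indicator_iff less_top)
  have "(\<lambda>x. indicator (digit_cylinder A d) x * digit_sign S (real_digit x)) \<in> borel_measurable borel"
    using assms unfolding digit_sign_def real_digit_def by measurable
  then show "(\<lambda>x. indicator (digit_cylinder A d) x * digit_sign S (real_digit x)) \<in> borel_measurable lebesgue"
    by (simp add: measurable_completion)
qed (simp add: abs_mult)

text \<open>Positions of \<open>S\<close> are removed one at a time. If \<open>i \<in> A\<close>,
  its factor is constant on the cylinder; otherwise the two values of digit \<open>i\<close>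
  contribute opposite integrals. This split prescribes a new digit, so \<open>A\<close> and
  \<open>d\<close> must vary in the induction.\<close>

lemma integral_indicator_mult_digit_sign:
  assumes "finite S" "finite A" "\<And>i. i \<in> A \<Longrightarrow> d i \<in> {0, 1}"
  shows "(LINT x|lebesgue. indicator (digit_cylinder A d) x * digit_sign S (real_digit x))
    = (if S \<subseteq> A then digit_sign S d / 2 ^ card A else 0)"
  using assms
proof (induction S arbitrary: A d rule: finite_induct)
  case empty
  have "digit_cylinder A d \<in> sets lebesgue" using empty by simp
  then show ?case using measure_digit_cylinder[OF empty] by (simp add: digit_sign_def)
next
  case (insert i S)
  have ins: "digit_sign (insert i S) e = (- 1) ^ e i * digit_sign S e" for e
    using insert.hyps by (simp add: digit_sign_def)
  show ?case
  proof (cases "i \<in> A")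
    case True
    have eq: "indicator (digit_cylinder A d) x * digit_sign (insert i S) (real_digit x)
      = (- 1) ^ d i * (indicator (digit_cylinder A d) x * digit_sign S (real_digit x))" for x
      using True by (auto simp: ins indicator_def digit_cylinder_def)
    show ?thesis unfolding eq using insert.IH[of A d] insert.prems True ins[of d] by simp
  next
    case False
    let ?C = "\<lambda>b. digit_cylinder (insert i A) (d(i := b))"
    have split: "indicator (digit_cylinder A d) x * digit_sign (insert i S) (real_digit x)
      = indicator (?C 0) x * digit_sign S (real_digit x) - indicator (?C 1) x * digit_sign S (real_digit x)" for x
      using False real_digit_cases[of x i] by (auto simp: ins indicator_def digit_cylinder_def)
    \<comment> \<open>As \<open>i\<close> is not in \<open>S\<close>, the value prescribed at
      \<open>i\<close> does not affect the remaining sign, and the two halves have equal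
      integrals.\<close>
    have sign: "digit_sign S (d(i := b)) = digit_sign S d" for b
      unfolding digit_sign_def using insert.hyps(2) by (intro prod.cong) auto
    have I: "(LINT x|lebesgue. indicator (?C b) x * digit_sign S (real_digit x))
      = (if S \<subseteq> insert i A then digit_sign S d / 2 ^ card (insert i A) else 0)" if "b \<in> {0, 1}" for b
    proof -
      have "(d(i := b)) j \<in> {0, 1}" if "j \<in> insert i A" for j
        using insert.prems(2) that \<open>b \<in> {0, 1}\<close> by auto
      then show ?thesis
        using insert.IH[of "insert i A" "d(i := b)"] insert.prems(1) unfolding sign by blast
    qed
    have "(LINT x|lebesgue. indicator (digit_cylinder A d) x * digit_sign (insert i S) (real_digit x)) = 0"
      unfolding split using insert.prems(1) insert.hyps(1)
      by (subst Bochner_Integration.integral_diff) (simp_all add: integrable_indicator_mult_digit_sign I)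
    then show ?thesis using False by simp
  qed
qed

lemma walsh_coeff_digit_cylinder:
  assumes "finite A" "\<And>i. i \<in> A \<Longrightarrow> d i \<in> {0, 1}"
  shows "walsh_coeff (indicator (digit_cylinder A d)) j
    = (if digit_support j \<subseteq> A then digit_sign (digit_support j) d / 2 ^ card A else 0)"
proof -
  have "walsh_coeff (indicator (digit_cylinder A d)) j
    = (LINT x|lebesgue. indicator (digit_cylinder A d) x * digit_sign (digit_support j) (real_digit x))"
    unfolding walsh_coeff_def set_lebesgue_integral_def
    by (rule Bochner_Integration.integral_cong)
      (auto simp: walsh_eq_digit_sign indicator_def digit_cylinder_def)
  then show ?thesis using integral_indicator_mult_digit_sign[of "digit_support j" A d] assms by simp
qed

text \<open>The sign of the coefficient and the Walsh function at \<open>x\<close> merge into one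
  sign for the sequence \<open>d k + real_digit x k\<close>, which for \<open>k \<in> A\<close> is
  odd exactly where \<open>x\<close> disagrees with \<open>d\<close>.\<close>

lemma walsh_partial_sum_digit_cylinder:
  assumes "finite A" "\<And>i. i \<in> A \<Longrightarrow> d i \<in> {0, 1}"
  shows "walsh_partial_sum m x (indicator (digit_cylinder A d))
    = (\<Sum>j | j < m \<and> digit_support j \<subseteq> A. digit_sign (digit_support j) (\<lambda>k. d k + real_digit x k)) / 2 ^ card A"
proof -
  have "walsh_partial_sum m x (indicator (digit_cylinder A d))
    = (\<Sum>j<m. if digit_support j \<subseteq> A
         then digit_sign (digit_support j) (\<lambda>k. d k + real_digit x k) / 2 ^ card A else 0)"
    unfolding walsh_partial_sum_def
    by (rule sum.cong)
      (auto simp: walsh_coeff_digit_cylinder[OF assms] walsh_eq_digit_sign digit_sign_def power_add prod.distrib)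
  also have "\<dots> = (\<Sum>j | j < m \<and> digit_support j \<subseteq> A.
      digit_sign (digit_support j) (\<lambda>k. d k + real_digit x k) / 2 ^ card A)"
    by (subst sum.inter_filter[symmetric]) (auto intro: sum.cong)
  finally show ?thesis by (simp add: sum_divide_distrib)
qed

section \<open>Cancellation in the sums of signs\<close>

lemma digit_sum_le_card:
  assumes "finite A"
  shows "\<bar>\<Sum>j | j < m \<and> digit_support j \<subseteq> A. digit_sign (digit_support j) e\<bar> \<le> 2 ^ card A"
proof -
  have "\<bar>\<Sum>j | j < m \<and> digit_support j \<subseteq> A. digit_sign (digit_support j) e\<bar>
    \<le> (\<Sum>j | j < m \<and> digit_support j \<subseteq> A. \<bar>digit_sign (digit_support j) e\<bar>)"
    by (rule sum_abs)
  also have "\<dots> = card {j. j < m \<and> digit_support j \<subseteq> A}" by simp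
  also have "card {j. j < m \<and> digit_support j \<subseteq> A} \<le> card {j. digit_support j \<subseteq> A}"
    by (rule card_mono) (use card_digit_support_subset_le[OF assms] in auto)
  also have "\<dots> \<le> 2 ^ card A" by (rule card_digit_support_subset_le[OF assms])
  finally show ?thesis by simp
qed

lemma digit_sum_le_if_odd_digit:
  assumes "finite A" "a \<in> A" "odd (e a)"
  shows "\<bar>\<Sum>j | j < m \<and> digit_support j \<subseteq> A. digit_sign (digit_support j) e\<bar> \<le> 2 ^ card (A \<inter> {..<a})"
proof -
  let ?s = "\<lambda>j. digit_sign (digit_support j) e"
  define J where "J = {j. j < m \<and> digit_support j \<subseteq> A}"
  define J0 where "J0 = {j \<in> J. \<not> bit j a}"
  \<comment> \<open>The members of \<open>J0\<close> whose partner survives the cutoff;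
    \<open>J0 - P\<close> collects the terms left unpaired.\<close>
  define P where "P = {j \<in> J0. j + 2 ^ a < m}"
  have fin: "finite J" "finite J0" "P \<subseteq> J0" by (auto simp: J_def J0_def P_def)
  \<comment> \<open>Adding 2^a to a number whose bit \<open>a\<close> is clear causes no
    carry.\<close>
  have set: "set_bit a j = j + 2 ^ a" if "\<not> bit j a" for j :: nat
    using that by (simp add: set_bit_eq)
  have supp: "digit_support (j + 2 ^ a) = insert a (digit_support j)" if "\<not> bit j a" for j
    by (auto simp: digit_support_def bit_set_bit_iff simp flip: set[OF that])
  have neg: "?s (j + 2 ^ a) = - ?s j" if "\<not> bit j a" for j
    using that assms(3) by (simp add: supp) (simp add: digit_sign_def digit_support_def finite_digit_support[unfolded digit_support_def])
  have J1: "{j \<in> J. bit j a} = (\<lambda>j. j + 2 ^ a) ` P"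
  \<comment> \<open>Clearing bit \<open>a\<close> keeps the support in \<open>A\<close> and the
    number below \<open>m\<close>; conversely, \<open>a \<in> A\<close> permits setting the
    bit.\<close>
  proof (intro equalityI subsetI)
    fix j assume j: "j \<in> {j \<in> J. bit j a}"
    let ?i = "unset_bit a j"
    have nb: "\<not> bit ?i a" by (simp add: bit_unset_bit_iff)
    have "set_bit a ?i = j"
      using j by (intro bit_eqI) (auto simp: bit_set_bit_iff bit_unset_bit_iff)
    then have eq: "?i + 2 ^ a = j" using set[OF nb] by simp
    then have "digit_support ?i \<subseteq> A" using supp[OF nb] j by (auto simp: J_def)
    then have "?i \<in> P" using eq nb j by (auto simp: P_def J0_def J_def)
    then show "j \<in> (\<lambda>j. j + 2 ^ a) ` P" using eq by (metis image_eqI)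
  next
    fix j assume "j \<in> (\<lambda>j. j + 2 ^ a) ` P"
    then obtain i where "i \<in> P" "j = i + 2 ^ a" by blast
    then show "j \<in> {j \<in> J. bit j a}"
      using supp[of i] assms(2) by (auto simp: P_def J0_def J_def digit_support_def)
  qed
  have "sum ?s J = sum ?s J0 + sum ?s {j \<in> J. bit j a}"
    unfolding J0_def using fin(1) by (subst sum.union_disjoint[symmetric]) (auto intro: sum.cong)
  also have "sum ?s {j \<in> J. bit j a} = (\<Sum>j\<in>P. ?s (j + 2 ^ a))"
    unfolding J1 by (subst sum.reindex) (auto simp: inj_on_def)
  also have "\<dots> = (\<Sum>j\<in>P. - ?s j)"
    by (rule sum.cong) (auto simp: P_def J0_def neg)
  also have "sum ?s J0 + \<dots> = sum ?s (J0 - P)"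
    using fin by (simp add: sum_diff sum_negf)
  finally have "\<bar>sum ?s J\<bar> \<le> (\<Sum>j\<in>J0 - P. \<bar>?s j\<bar>)"
    using sum_abs[of ?s "J0 - P"] by simp
  also have "\<dots> = card (J0 - P)" by simp
  also have "card (J0 - P) \<le> card {i. digit_support i \<subseteq> A \<inter> {..<a}}"
  proof (rule card_inj_on_le)
    \<comment> \<open>Unpaired \<open>j\<close> satisfy \<open>j < m \<le> j + 2 ^ a\<close>, so two
      of them differ by less than 2^a and their residues modulo 2^a tell them apart.\<close>
    show "inj_on (take_bit a) (J0 - P)"
    proof (rule inj_onI)
      have eq: "i = j" if "i \<le> j" "j < m" "m \<le> i + 2 ^ a" "i mod 2 ^ a = j mod 2 ^ a" for i j
      proof -
        have "2 ^ a dvd j - i" using that by (metis mod_eq_dvd_iff_nat)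
        then show ?thesis using that dvd_imp_le[of "2 ^ a" "j - i"] by (cases "i = j") linarith+
      qed
      fix i j assume "i \<in> J0 - P" "j \<in> J0 - P" and mod: "take_bit a i = take_bit a j"
      then have "i < m" "j < m" "m \<le> i + 2 ^ a" "m \<le> j + 2 ^ a"
        by (auto simp: P_def J0_def J_def)
      then show "i = j"
        using eq mod unfolding take_bit_eq_mod by (metis nat_le_linear)
    qed
    show "take_bit a ` (J0 - P) \<subseteq> {i. digit_support i \<subseteq> A \<inter> {..<a}}"
      by (auto simp: J0_def J_def digit_support_def bit_take_bit_iff)
    show "finite {i. digit_support i \<subseteq> A \<inter> {..<a}}"
      by (rule card_digit_support_subset_le) simp
  qed
  also have "\<dots> \<le> 2 ^ card (A \<inter> {..<a})" by (rule card_digit_support_subset_le) simp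
  finally show ?thesis by (simp add: J_def)
qed

section \<open>The weak type bound for cylinders\<close>

lemma walsh_maximal_weak_type_digit_cylinder:
  assumes A: "finite A" "\<And>i. i \<in> A \<Longrightarrow> d i \<in> {0, 1}" and lam: "lam > 0"
  shows "measure lebesgue {x \<in> {0..<1}. walsh_maximal x (indicator (digit_cylinder A d)) > ereal lam}
    \<le> measure lebesgue (digit_cylinder A d) / lam"
    (is "measure lebesgue ?L \<le> _")
\<comment> \<open>The nonempty case supplies a point of the level set, from which
  \<open>lam < 1\<close> follows when \<open>A' = A\<close>.\<close>
proof (cases "?L = {}")
  case True
  show ?thesis unfolding True using lam by simp
next
  case False
  let ?T = "\<lambda>m x. \<Sum>j | j < m \<and> digit_support j \<subseteq> A. digit_sign (digit_support j) (\<lambda>k. d k + real_digit x k)"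
  \<comment> \<open>The positions at which a disagreement with \<open>d\<close> bounds all partial
    sums by \<open>lam\<close> in absolute value.\<close>
  define A' where "A' = {a \<in> A. 2 ^ card (A \<inter> {..<a}) \<le> 2 ^ card A * lam}"
  have T: "\<exists>m. 2 ^ card A * lam < \<bar>?T m x\<bar>" if "x \<in> ?L" for x
  proof -
    have "ereal lam < (SUP m. ereal \<bar>walsh_partial_sum m x (indicator (digit_cylinder A d))\<bar>)"
      using that by (simp add: walsh_maximal_def)
    then obtain m where "lam < \<bar>walsh_partial_sum m x (indicator (digit_cylinder A d))\<bar>"
      unfolding less_SUP_iff by auto
    then show ?thesis
      by (auto simp: walsh_partial_sum_digit_cylinder[OF A] field_simps intro!: exI[of _ m])
  qed
  have A': "finite A'" "A' \<subseteq> A" using A(1) by (auto simp: A'_def)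
  have "?L \<subseteq> digit_cylinder A' d"
  proof
    fix x assume x: "x \<in> ?L"
    obtain m where m: "2 ^ card A * lam < \<bar>?T m x\<bar>" using T[OF x] by blast
    have "real_digit x a = d a" if "a \<in> A'" for a
    proof (rule ccontr)
      assume "real_digit x a \<noteq> d a"
      then have "odd (d a + real_digit x a)"
        using real_digit_cases[of x a] A(2)[of a] A' that by auto
      then have "\<bar>?T m x\<bar> \<le> 2 ^ card (A \<inter> {..<a})"
        using A(1) A' that by (intro digit_sum_le_if_odd_digit) auto
      then show False using m that by (auto simp: A'_def)
    qed
    then show "x \<in> digit_cylinder A' d" using x by (auto simp: digit_cylinder_def)
  qed
  then have "measure lebesgue ?L \<le> measure lebesgue (digit_cylinder A' d)"
    using digit_cylinder_finite_measure[OF A'(1), of d] A'(1) walsh_maximal_level_set_borel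
    by (intro measure_mono_fmeasurable) (auto simp: fmeasurable_def)
  also have "\<dots> = 1 / 2 ^ card A'" using A' A(2) by (intro measure_digit_cylinder) auto
  also have "\<dots> \<le> 1 / (2 ^ card A * lam)"
  proof -
    have "2 ^ card A * lam \<le> 2 ^ card A'"
    proof (cases "A' = A")
      case True
      obtain x m where "2 ^ card A * lam < \<bar>?T m x\<bar>" using T False by blast
      then show ?thesis using digit_sum_le_card[OF A(1)] True by (meson less_eq_real_def order_less_le_trans)
    next
      case False
      \<comment> \<open>All elements of \<open>A\<close> below the least missing position lie in
        \<open>A'\<close>, while the failure of the defining inequality at \<open>a\<close> bounds
        \<open>2 ^ card A * lam\<close> from above.\<close>
      define a where "a = (LEAST a. a \<in> A - A')"
      have a: "a \<in> A - A'" unfolding a_def using False A' by (metis Diff_eq_empty_iff LeastI ex_in_conv subset_antisym)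
      have "b \<notin> A - A'" if "b < a" for b
        using not_less_Least that unfolding a_def .
      then have "A \<inter> {..<a} \<subseteq> A'" by blast
      then have "card (A \<inter> {..<a}) \<le> card A'" using A' card_mono by blast
      then have "(2::real) ^ card (A \<inter> {..<a}) \<le> 2 ^ card A'" by simp
      moreover have "2 ^ card A * lam < 2 ^ card (A \<inter> {..<a})" using a by (auto simp: A'_def)
      ultimately show ?thesis by linarith
    qed
    then show ?thesis using lam by (intro divide_left_mono) auto
  qed
  also have "\<dots> = measure lebesgue (digit_cylinder A d) / lam"
    using measure_digit_cylinder[OF A] by simp
  finally show ?thesis .
qed

section \<open>The set \<open>G\<close> as a digit cylinder, and the resulting bound\<close>

text \<open>Floors at coarser levels are integer quotients of the floor at level \<open>n\<close>,
  which gives the digits; conversely, the digits sum up to the floor divided by 2^n.\<close>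

lemma floor_eq_iff_real_digit_eq:
  assumes "x \<in> {0..<1}" "y \<in> {0..<1}"
  shows "\<lfloor>2 ^ n * x\<rfloor> = \<lfloor>2 ^ n * y\<rfloor> \<longleftrightarrow> (\<forall>i<n. real_digit x i = real_digit y i)"
proof
  assume eq: "\<lfloor>2 ^ n * x\<rfloor> = \<lfloor>2 ^ n * y\<rfloor>"
  have "\<lfloor>2 ^ Suc i * z\<rfloor> = \<lfloor>2 ^ n * z\<rfloor> div 2 ^ (n - Suc i)" if "i < n" for i and z :: real
  proof -
    have "(2::real) ^ n = 2 ^ Suc i * 2 ^ (n - Suc i)"
      using that by (metis Suc_leI le_add_diff_inverse power_add)
    then show ?thesis
      using floor_divide_real_eq_div[of "2 ^ (n - Suc i)" "2 ^ n * z"] by (simp add: mult.assoc)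
  qed
  then show "\<forall>i<n. real_digit x i = real_digit y i" unfolding real_digit_def using eq by metis
next
  assume "\<forall>i<n. real_digit x i = real_digit y i"
  then have "real_of_int \<lfloor>2 ^ n * x\<rfloor> / 2 ^ n = real_of_int \<lfloor>2 ^ n * y\<rfloor> / 2 ^ n"
    using assms by (auto simp flip: real_digit_partial_sum)
  then show "\<lfloor>2 ^ n * x\<rfloor> = \<lfloor>2 ^ n * y\<rfloor>" by simp
qed

text \<open>A dyadic interval is a level set of the floor of 2^n x. Reading the prescribed digits
  off a point \<open>y\<close> of it avoids expanding \<open>k - 1\<close> in binary.\<close>

lemma mem_dyadic_interval_iff:
  assumes "y \<in> dyadic_interval n k" "x \<in> {0..<1}" "y \<in> {0..<1}"
  shows "x \<in> dyadic_interval n k \<longleftrightarrow> (\<forall>i<n. real_digit x i = real_digit y i)"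
proof -
  have "z \<in> dyadic_interval n k \<longleftrightarrow> \<lfloor>2 ^ n * z\<rfloor> = int k - 1" for z
    unfolding dyadic_interval_def floor_eq_iff by (auto simp: field_simps)
  then show ?thesis using assms floor_eq_iff_real_digit_eq by metis
qed

text \<open>Multiplication by 2^l shifts digits by \<open>l\<close>; the integer part removed by
  \<open>frac\<close> changes the floor by an even number.\<close>

lemma real_digit_frac: "real_digit (frac (2 ^ l * x)) i = real_digit x (l + i)"
proof -
  have "\<lfloor>2 ^ Suc i * frac (2 ^ l * x)\<rfloor> = \<lfloor>2 ^ Suc (l + i) * x - of_int (2 ^ Suc i * \<lfloor>2 ^ l * x\<rfloor>)\<rfloor>"
    by (simp add: frac_def algebra_simps power_add)
  also have "\<dots> = \<lfloor>2 ^ Suc (l + i) * x\<rfloor> - 2 ^ Suc i * \<lfloor>2 ^ l * x\<rfloor>"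
    by (rule floor_diff_of_int)
  finally have "\<lfloor>2 ^ Suc i * frac (2 ^ l * x)\<rfloor> mod 2 = \<lfloor>2 ^ Suc (l + i) * x\<rfloor> mod 2"
    by (simp add: mod_eq_dvd_iff)
  then show ?thesis by (simp add: real_digit_def)
qed

text \<open>The interval prescribes the first \<open>n\<close> digits, the dilated set the
  \<open>r\<close> digits from position \<open>l\<close> on. The blocks overlap if
  \<open>l < n\<close>; taking both from one point \<open>y\<close> of the set makes them
  consistent.\<close>

lemma G_set_eq_digit_cylinder:
  assumes y: "y \<in> G_set l (dyadic_interval n k) r t"
  shows "G_set l (dyadic_interval n k) r t = digit_cylinder ({..<n} \<union> {l..<l + r}) (real_digit y)"
proof -
  have y': "y \<in> dyadic_interval n k" "y \<in> {0..<1}" "frac (2 ^ l * y) \<in> dyadic_interval r t"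
    using y by (auto simp: G_set_def periodic_dilate_def)
  have fr: "frac z \<in> {0..<1}" for z :: real by (simp add: frac_lt_1)
  have shift: "(\<forall>i<r. P (l + i)) \<longleftrightarrow> (\<forall>i\<in>{l..<l + r}. P i)" for P
    by (metis add_less_cancel_left atLeastLessThan_iff le_add1 le_add_diff_inverse)
  have "x \<in> G_set l (dyadic_interval n k) r t
    \<longleftrightarrow> x \<in> digit_cylinder ({..<n} \<union> {l..<l + r}) (real_digit y)" if "x \<in> {0..<1}" for x
    using that mem_dyadic_interval_iff[OF y'(1) that y'(2)] mem_dyadic_interval_iff[OF y'(3) fr fr, of "2 ^ l * x"]
      shift[of "\<lambda>i. real_digit x i = real_digit y i"]
    by (auto simp: G_set_def periodic_dilate_def digit_cylinder_def real_digit_frac)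
  moreover have "G_set l (dyadic_interval n k) r t \<subseteq> {0..<1}"
    by (auto simp: G_set_def periodic_dilate_def)
  ultimately show ?thesis by (auto simp: digit_cylinder_def)
qed

theorem proposition3:
  shows "\<exists>c::real. c > 0 \<and>
    (\<forall>(n::nat) (k::nat) (r::nat) (t::nat) (l::nat).
       1 \<le> k \<and> k \<le> 2 ^ n \<and> r > 0 \<and> 1 \<le> t \<and> t \<le> 2 ^ r \<and> l \<ge> 1 \<longrightarrow>
       (let G = G_set l (dyadic_interval n k) r t in
        \<forall>lam::real. lam > 0 \<longrightarrow>
          measure lebesgue {x \<in> {0..<1}. walsh_maximal x (indicator G) > ereal lam}
            \<le> c * (measure lebesgue G / lam)))"
proof (intro exI[of _ 1] conjI allI impI)
  fix n k r t l :: nat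
  assume "1 \<le> k \<and> k \<le> 2 ^ n \<and> r > 0 \<and> 1 \<le> t \<and> t \<le> 2 ^ r \<and> l \<ge> 1"
  define G where "G = G_set l (dyadic_interval n k) r t"
  have "measure lebesgue {x \<in> {0..<1}. walsh_maximal x (indicator G) > ereal lam}
    \<le> 1 * (measure lebesgue G / lam)" if lam: "lam > 0" for lam :: real
  proof (cases "G = {}")
    \<comment> \<open>With no point to read digits from, all coefficients vanish and both sides are
      0.\<close>
    case True
    then have "walsh_maximal x (indicator G) = 0" for x
      by (simp add: walsh_maximal_def walsh_partial_sum_def walsh_coeff_def set_lebesgue_integral_def zero_ereal_def)
    then show ?thesis using lam by simp
  next
    case False
    then obtain y where "y \<in> G" by blast
    then have "G = digit_cylinder ({..<n} \<union> {l..<l + r}) (real_digit y)"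
      using G_set_eq_digit_cylinder by (simp add: G_def)
    then show ?thesis
      using walsh_maximal_weak_type_digit_cylinder[of "{..<n} \<union> {l..<l + r}" "real_digit y", OF _ _ lam]
        real_digit_cases by simp
  qed
  then show "let G = G_set l (dyadic_interval n k) r t in
        \<forall>lam::real. lam > 0 \<longrightarrow>
          measure lebesgue {x \<in> {0..<1}. walsh_maximal x (indicator G) > ereal lam}
            \<le> 1 * (measure lebesgue G / lam)"
    by (simp add: G_def)
qed simp

end
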